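(* Suppose that $X$ is a space that is not countably compact. If $d(X)$ is less than the first weakly inaccessible cardinal, then $X^{d(X)}$ is $e$-separable.
   Context: All topological spaces are assumed to be $T_1$. A space $Z$ is $e$-separable if there is a sequence $(D_n)_{n\in\omega}$ of closed discrete subspaces of $Z$ such that $\bigcup_{n\in\omega}D_n$ is dense in $Z$. The density $d(Z)$ is the smallest cardinality of a dense subset of $Z$. A space is countably compact if every countable open cover has a finite subcover. A weakly inaccessible cardinal is an uncountable regular limit cardinal; if there is none, the condition "less than the first weakly inaccessible cardinal" is regarded as satisfied. Powers carry the Tychonoff product topology. *)

theory Defs
  imports "HOL-Analysis.Analysis"
begin

unbundle cardinal_syntax

definition countably_compact_space :: "'a topology \<Rightarrow> bool" where
  "countably_compact_space X \<longleftrightarrow>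
     (\<forall>\<U>. countable \<U> \<and> (\<forall>U\<in>\<U>. openin X U) \<and> topspace X \<subseteq> \<Union>\<U>
        \<longrightarrow> (\<exists>\<F>. finite \<F> \<and> \<F> \<subseteq> \<U> \<and> topspace X \<subseteq> \<Union>\<F>))"

definition dense_in :: "'a topology \<Rightarrow> 'a set \<Rightarrow> bool" where
  "dense_in X D \<longleftrightarrow> D \<subseteq> topspace X \<and> X closure_of D = topspace X"

definition closed_discrete_in :: "'a topology \<Rightarrow> 'a set \<Rightarrow> bool" where
  "closed_discrete_in X D \<longleftrightarrow> closedin X D \<and> subtopology X D = discrete_topology D"

definition e_separable :: "'a topology \<Rightarrow> bool" where
  "e_separable X \<longleftrightarrow>
     (\<exists>D :: nat \<Rightarrow> 'a set. (\<forall>n. closed_discrete_in X (D n)) \<and> dense_in X (\<Union>n. D n))"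

(* A cardinal is represented, as in the library, by a cardinal order, determined only up to =o. *)
definition topological_density :: "'a topology \<Rightarrow> 'a rel" where
  "topological_density X = |SOME D. dense_in X D \<and> (\<forall>E. dense_in X E \<longrightarrow> |D| \<le>o |E| )|"

lemma topological_density_properties:
  shows "Card_order (topological_density X)"
    and "\<exists>D. dense_in X D \<and> |D| =o topological_density X"
    and "dense_in X E \<Longrightarrow> topological_density X \<le>o |E|"
proof -
  let ?P = "\<lambda>D. dense_in X D \<and> (\<forall>E. dense_in X E \<longrightarrow> |D| \<le>o |E| )"
  let ?R = "{ |D| | D. dense_in X D}"
  have "dense_in X (topspace X)"
    by (simp add: dense_in_def)
  then have "?R \<noteq> {}"
    by blast
  moreover have "\<forall>r\<in>?R. Card_order r"
    by (auto simp: card_of_Card_order)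
  ultimately obtain r where "r \<in> ?R" "\<forall>r'\<in>?R. r \<le>o r'"
    using exists_minim_Card_order[of ?R] by blast
  then have "\<exists>D. ?P D"
    by blast
  then have P: "?P (SOME D. ?P D)"
    by (rule someI_ex)
  show "Card_order (topological_density X)"
    unfolding topological_density_def by (rule card_of_Card_order)
  show "\<exists>D. dense_in X D \<and> |D| =o topological_density X"
    unfolding topological_density_def using P by (blast intro: card_of_refl)
  show "dense_in X E \<Longrightarrow> topological_density X \<le>o |E|"
    unfolding topological_density_def using P by blast
qed

definition limit_cardinal :: "'a rel \<Rightarrow> bool" where
  "limit_cardinal \<kappa> \<longleftrightarrow>
     Card_order \<kappa> \<and> (\<forall>\<mu> :: 'a rel. Card_order \<mu> \<and> \<mu> <o \<kappa> \<longrightarrow> cardSuc \<mu> <o \<kappa>)"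

definition weakly_inaccessible :: "'a rel \<Rightarrow> bool" where
  "weakly_inaccessible \<kappa> \<longleftrightarrow>
     Card_order \<kappa> \<and> natLeq <o \<kappa> \<and> regularCard \<kappa> \<and> limit_cardinal \<kappa>"

(* Quantifying over the cardinals on the type 'a of r is enough: a weakly inaccessible cardinal
   of any other type that is \<le>o r has a copy on 'a (see the lemma below). *)
definition below_first_weakly_inaccessible :: "'a rel \<Rightarrow> bool" where
  "below_first_weakly_inaccessible r \<longleftrightarrow> (\<forall>\<kappa> :: 'a rel. weakly_inaccessible \<kappa> \<longrightarrow> r <o \<kappa>)"

lemma below_first_weakly_inaccessible_any_type:
  fixes r :: "'a rel" and \<kappa> :: "'b rel"
  assumes r: "Card_order r" "below_first_weakly_inaccessible r"
    and \<kappa>: "weakly_inaccessible \<kappa>"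
  shows "r <o \<kappa>"
proof (rule ccontr)
  have co: "Card_order \<kappa>" and unc: "natLeq <o \<kappa>" and reg: "regularCard \<kappa>"
    and lim: "\<And>\<mu> :: 'b rel. Card_order \<mu> \<Longrightarrow> \<mu> <o \<kappa> \<Longrightarrow> cardSuc \<mu> <o \<kappa>"
    using \<kappa> by (auto simp: weakly_inaccessible_def limit_cardinal_def)
  assume "\<not> r <o \<kappa>"
  then have le: "\<kappa> \<le>o r"
    using not_ordLess_iff_ordLeq[OF card_order_on_well_order_on[OF co] card_order_on_well_order_on[OF r(1)]]
    by simp
  then obtain \<kappa>' :: "'a rel" where iso: "\<kappa> =o \<kappa>'" and le': "\<kappa>' \<le>o r"
    using internalize_ordLeq[of \<kappa> r] by blast
  have co': "Card_order \<kappa>'"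
    using co iso Card_order_ordIso2 by blast
  have unc': "natLeq <o \<kappa>'"
    using unc iso ordLess_ordIso_trans by blast
  have inf: "\<not> finite (Field \<kappa>)"
    using cinfinite_mono[OF ordLess_imp_ordLeq[OF unc] natLeq_cinfinite]
    by (simp add: cinfinite_def)
  have inf': "\<not> finite (Field \<kappa>')"
    using inf iso card_of_cong card_of_ordIso_finite by blast
  have "stable \<kappa>'"
    using stable_ordIso1[OF regularCard_stable[OF co inf reg] ordIso_symmetric[OF iso]] .
  then have "regularCard \<kappa>'"
    using stable_regularCard[OF co' inf'] by blast
  moreover have "cardSuc \<mu> <o \<kappa>'" if \<mu>: "Card_order \<mu>" "\<mu> <o \<kappa>'" for \<mu> :: "'a rel"
  proof -
    have "\<mu> <o \<kappa>"
      using \<mu>(2) iso ordIso_symmetric ordLess_ordIso_trans by blast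
    then obtain \<nu> :: "'b rel" where \<nu>: "\<mu> =o \<nu>" "\<nu> <o \<kappa>"
      using internalize_ordLess[of \<mu> \<kappa>] by blast
    then have co\<nu>: "Card_order \<nu>"
      using \<mu>(1) Card_order_ordIso2 by blast
    have "cardSuc \<mu> =o cardSuc \<nu>"
      using cardSuc_invar_ordIso[OF \<mu>(1) co\<nu>] \<nu>(1) by blast
    then show ?thesis
      using lim[OF co\<nu> \<nu>(2)] iso ordIso_ordLess_trans ordLess_ordIso_trans by blast
  qed
  ultimately have "weakly_inaccessible \<kappa>'"
    using co' unc' by (simp add: weakly_inaccessible_def limit_cardinal_def)
  then have "r <o \<kappa>'"
    using r(2) by (simp add: below_first_weakly_inaccessible_def)
  then show False
    using le' not_ordLess_ordLeq by blast
qed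

end

theory Submission
  imports Defs "HOL-Library.Countable_Set_Type"
begin

text \<open>By Mycielski's theorem, the power of the discrete space of natural numbers with exponent
  \<open>\<kappa>\<close> contains a closed discrete set of size \<open>\<kappa>\<close> whenever \<open>\<kappa>\<close> is below the first weakly
  inaccessible cardinal; the induction on \<open>\<kappa>\<close> only has to pass successor and singular cardinals.
  As \<open>X\<close> is \<open>T\<^sub>1\<close> and not countably compact, it contains an infinite closed discrete sequence,
  so Mycielski's sets embed in powers of \<open>X\<close>. Split the \<open>d(X)\<close> coordinates into countably many
  blocks of size \<open>d(X)\<close>. In the \<open>n\<close>-th closed discrete set, a finitely supported point over a
  dense subset of \<open>X\<close> is placed outside block \<open>n\<close>, while its coordinates in block \<open>n\<close> are replaced
  by a code for it taken from the closed discrete set of that block. A basic open set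
  restricts only finitely many coordinates and so leaves some block free.\<close>

section \<open>Separating codes in powers of the natural numbers\<close>

text \<open>There are \<open>|A|\<close> points of \<open>\<nat>\<^sup>J\<close> such that every point of \<open>\<nat>\<^sup>J\<close> has a basic neighbourhood
  containing at most one of them.\<close>

definition discretely_coded :: "'a set \<Rightarrow> 'j set \<Rightarrow> bool" where
  "discretely_coded A J \<longleftrightarrow>
     (\<exists>c :: 'a \<Rightarrow> 'j \<Rightarrow> nat. \<forall>y. \<exists>F d. finite F \<and> F \<subseteq> J \<and>
        (\<forall>a\<in>A. (\<forall>j\<in>F. c a j = y j) \<longrightarrow> a = d))"

text \<open>Skolemized form: the test set \<open>F\<close> and the decoded element \<open>d\<close>
  become functions of \<open>y\<close>, as needed to decode in several stages.\<close>

lemma discretely_coded_iff: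
  "discretely_coded (A :: 'a set) (J :: 'j set) \<longleftrightarrow>
     (\<exists>(c :: 'a \<Rightarrow> 'j \<Rightarrow> nat) F d. \<forall>y. finite (F y) \<and> F y \<subseteq> J \<and> (\<forall>a\<in>A. (\<forall>j\<in>F y. c a j = y j) \<longrightarrow> a = d y))"
  unfolding discretely_coded_def choice_iff by (rule refl)

text \<open>Codes are pulled back along an injection of \<open>A'\<close> into \<open>A\<close>, and
  coordinates are relabelled by an injection of \<open>J\<close> into \<open>J'\<close>. Hence only
  cardinalities matter.\<close>

lemma discretely_coded_mono:
  fixes A :: "'a set" and J :: "'j set"
  assumes "discretely_coded A J" "|A'| \<le>o |A|" "|J| \<le>o |J'|"
  shows "discretely_coded A' J'"
proof -
  obtain c :: "'a \<Rightarrow> 'j \<Rightarrow> nat" and F d where "\<forall>y. finite (F y) \<and> F y \<subseteq> J \<and>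
      (\<forall>a\<in>A. (\<forall>j\<in>F y. c a j = y j) \<longrightarrow> a = d y)"
    using assms(1) unfolding discretely_coded_iff by (elim exE)
  then have F: "\<And>y. finite (F y)" "\<And>y. F y \<subseteq> J"
    and d: "\<And>y a. a \<in> A \<Longrightarrow> (\<And>j. j \<in> F y \<Longrightarrow> c a j = y j) \<Longrightarrow> a = d y"
    by blast+
  obtain f where f: "inj_on f A'" "f ` A' \<subseteq> A"
    using assms(2) unfolding card_of_ordLeq[symmetric] by blast
  obtain h where h: "inj_on h J" "h ` J \<subseteq> J'"
    using assms(3) unfolding card_of_ordLeq[symmetric] by blast
  show ?thesis
    unfolding discretely_coded_def
  \<comment> \<open>Off the image of \<open>h\<close> the relabelling is arbitrary; this is harmless
    because every test set lies in that image.\<close>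
  proof (intro exI[of _ "\<lambda>a j. c (f a) (inv_into J h j)"] allI)
    fix y
    show "\<exists>H e. finite H \<and> H \<subseteq> J' \<and>
      (\<forall>a\<in>A'. (\<forall>j\<in>H. c (f a) (inv_into J h j) = y j) \<longrightarrow> a = e)"
    proof (intro exI conjI ballI impI)
      show "finite (h ` F (y \<circ> h))" "h ` F (y \<circ> h) \<subseteq> J'"
        using F h(2) by blast+
      fix a
      assume a: "a \<in> A'" and agree: "\<forall>j\<in>h ` F (y \<circ> h). c (f a) (inv_into J h j) = y j"
      have "f a = d (y \<circ> h)"
      proof (rule d)
        show "f a \<in> A"
          using a f(2) by blast
        show "c (f a) j = (y \<circ> h) j" if "j \<in> F (y \<circ> h)" for j
          using agree that inv_into_f_f[OF h(1)] F(2) by fastforce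
      qed
      then show "a = inv_into A' f (d (y \<circ> h))"
        using inv_into_f_f[OF f(1) a] by simp
    qed
  qed
qed

text \<open>Constant functions suffice: any one coordinate shows the index of \<open>a\<close> in an
  enumeration.\<close>

lemma discretely_coded_countable:
  assumes "countable A"
  shows "discretely_coded A A"
  unfolding discretely_coded_def
proof (intro exI[of _ "\<lambda>a _. to_nat_on A a"] allI)
  fix y :: "'a \<Rightarrow> nat"
  show "\<exists>F d. finite F \<and> F \<subseteq> A \<and> (\<forall>a\<in>A. (\<forall>j\<in>F. to_nat_on A a = y j) \<longrightarrow> a = d)"
  proof (cases "A = {}")
    case False
    then obtain j where j: "j \<in> A"
      by blast
    then show ?thesis
      using from_nat_into_to_nat_on[OF assms]
      by (intro exI[of _ "{j}"] exI[of _ "from_nat_into A (y j)"]) force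
  qed auto
qed

text \<open>Decoding has two stages: the left coordinates reveal an index \<open>k\<close>, and this
  tells which of the right blocks to read in order to find the element of \<open>S k\<close>. This
  serves the singular case.\<close>

lemma discretely_coded_UN:
  fixes S :: "'k \<Rightarrow> 'a set" and J :: "'j set"
  assumes K: "discretely_coded K J" and S: "\<And>k. k \<in> K \<Longrightarrow> discretely_coded (S k) J"
  shows "discretely_coded (\<Union>k\<in>K. S k) (J <+> K \<times> J)"
proof -
  obtain c :: "'k \<Rightarrow> 'j \<Rightarrow> nat" and F d where "\<forall>y. finite (F y) \<and> F y \<subseteq> J \<and>
      (\<forall>a\<in>K. (\<forall>j\<in>F y. c a j = y j) \<longrightarrow> a = d y)"
    using K unfolding discretely_coded_iff by (elim exE)
  then have F: "\<And>y. finite (F y)" "\<And>y. F y \<subseteq> J"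
    and d: "\<And>y a. a \<in> K \<Longrightarrow> (\<And>j. j \<in> F y \<Longrightarrow> c a j = y j) \<Longrightarrow> a = d y"
    by blast+
  have "\<forall>k\<in>K. \<exists>(c :: 'a \<Rightarrow> 'j \<Rightarrow> nat) F d. \<forall>y. finite (F y) \<and> F y \<subseteq> J \<and>
      (\<forall>a\<in>S k. (\<forall>j\<in>F y. c a j = y j) \<longrightarrow> a = d y)"
    using S unfolding discretely_coded_iff by blast
  then obtain cS :: "'k \<Rightarrow> 'a \<Rightarrow> 'j \<Rightarrow> nat" and G e where "\<forall>k\<in>K. \<forall>y. finite (G k y) \<and> G k y \<subseteq> J \<and>
      (\<forall>a\<in>S k. (\<forall>j\<in>G k y. cS k a j = y j) \<longrightarrow> a = e k y)"
    unfolding bchoice_iff by blast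
  then have G: "\<And>k y. k \<in> K \<Longrightarrow> finite (G k y) \<and> G k y \<subseteq> J"
    and e: "\<And>k y a. k \<in> K \<Longrightarrow> a \<in> S k \<Longrightarrow> (\<And>j. j \<in> G k y \<Longrightarrow> cS k a j = y j) \<Longrightarrow> a = e k y"
    by blast+
  \<comment> \<open>The sets \<open>S k\<close> may overlap, so each element is given one fixed
    index.\<close>
  define ix where "ix a = (SOME k. k \<in> K \<and> a \<in> S k)" for a
  have ix: "ix a \<in> K \<and> a \<in> S (ix a)" if "a \<in> (\<Union>k\<in>K. S k)" for a
    unfolding ix_def by (rule someI_ex) (use that in blast)
  \<comment> \<open>All blocks \<open>(k, j)\<close> are filled, but only the block with
    \<open>k = ix a\<close> is sure to carry a meaningful code of \<open>a\<close>.\<close>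
  define C where "C a = case_sum (c (ix a)) (\<lambda>(k, j). cS k a j)" for a
  show ?thesis
    unfolding discretely_coded_def
  proof (intro exI[of _ C] allI)
    fix y :: "'j + 'k \<times> 'j \<Rightarrow> nat"
    let ?k = "d (y \<circ> Inl)"
    let ?z = "\<lambda>j. y (Inr (?k, j))"
    \<comment> \<open>If the decoded index is not in \<open>K\<close>, the left coordinates already
      exclude every element, and nothing is known about \<open>G\<close> there.\<close>
    let ?H = "Inl ` F (y \<circ> Inl) \<union> (if ?k \<in> K then (\<lambda>j. Inr (?k, j)) ` G ?k ?z else {})"
    show "\<exists>H b. finite H \<and> H \<subseteq> J <+> K \<times> J \<and>
        (\<forall>a\<in>\<Union> (S ` K). (\<forall>j\<in>H. C a j = y j) \<longrightarrow> a = b)"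
    proof (intro exI[of _ ?H] exI[of _ "e ?k ?z"] conjI ballI impI)
      show "finite ?H"
        using F G by simp
      show "?H \<subseteq> J <+> K \<times> J"
        using F(2)[of "y \<circ> Inl"] G[of ?k ?z] by auto
      fix a
      assume a: "a \<in> \<Union> (S ` K)" and agree: "\<forall>j\<in>?H. C a j = y j"
      have Inl: "c (ix a) j = y (Inl j)" if "j \<in> F (y \<circ> Inl)" for j
        using bspec[OF agree, of "Inl j"] that by (simp add: C_def)
      have Inr: "cS ?k a j = ?z j" if "?k \<in> K" "j \<in> G ?k ?z" for j
        using bspec[OF agree, of "Inr (?k, j)"] that by (simp add: C_def)
      have k: "ix a = ?k"
        by (rule d) (use ix[OF a] Inl in auto)
      show "a = e ?k ?z"
      proof (rule e)
        show K: "?k \<in> K" and "a \<in> S ?k"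
          using ix[OF a] k by auto
        show "cS ?k a j = ?z j" if "j \<in> G ?k ?z" for j
          using Inr[OF K that] .
      qed
    qed
  qed
qed

text \<open>Comparing \<open>a\<close> with a coordinate \<open>b\<close> through an injection of the initial segment up to the
  larger of the two into \<open>B\<close> gives points of \<open>B\<^sup>A\<close>. A point \<open>y\<close> of \<open>B\<^sup>A\<close> takes the same
  value at some \<open>b < b'\<close>; no \<open>a \<ge> b'\<close> agrees with \<open>y\<close> at both, and the value at \<open>b'\<close> determines \<open>a < b'\<close>.\<close>

lemma discretely_coded_step:
  fixes A :: "'a set" and B :: "'b set" and J :: "'j set"
  assumes B: "discretely_coded B J" and less: "|B| <o |A|"
    and seg: "\<And>a. a \<in> A \<Longrightarrow> |under |A| a| \<le>o |B|"
  shows "discretely_coded A (A \<times> J)"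
proof -
  let ?r = "|A|"
  have wo: "well_order_on A ?r"
    by (rule card_of_well_order_on)
  have total: "(a, b) \<in> ?r \<or> (b, a) \<in> ?r" if "a \<in> A" "b \<in> A" for a b
    using wo that unfolding well_order_on_def linear_order_on_def partial_order_on_def
      preorder_on_def total_on_def refl_on_def by metis
  have trans: "(a, c) \<in> ?r" if "(a, b) \<in> ?r" "(b, c) \<in> ?r" for a b c
    using wo that unfolding well_order_on_def linear_order_on_def partial_order_on_def
      preorder_on_def trans_def by metis
  obtain c :: "'b \<Rightarrow> 'j \<Rightarrow> nat" and F d where "\<forall>y. finite (F y) \<and> F y \<subseteq> J \<and>
      (\<forall>a\<in>B. (\<forall>j\<in>F y. c a j = y j) \<longrightarrow> a = d y)"
    using B unfolding discretely_coded_iff by (elim exE)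
  then have F: "\<And>y. finite (F y)" "\<And>y. F y \<subseteq> J"
    and d: "\<And>y a. a \<in> B \<Longrightarrow> (\<And>j. j \<in> F y \<Longrightarrow> c a j = y j) \<Longrightarrow> a = d y"
    by blast+
  have "\<forall>a\<in>A. \<exists>e. inj_on e (under ?r a) \<and> e ` under ?r a \<subseteq> B"
    using seg unfolding card_of_ordLeq[symmetric] by blast
  then obtain e where "\<forall>a\<in>A. inj_on (e a) (under ?r a) \<and> e a ` under ?r a \<subseteq> B"
    unfolding bchoice_iff by blast
  then have inj: "\<And>a. a \<in> A \<Longrightarrow> inj_on (e a) (under ?r a)"
    and e: "\<And>a. a \<in> A \<Longrightarrow> e a ` under ?r a \<subseteq> B"
    by blast+
  define p where "p a b = (if (b, a) \<in> ?r then e a b else e b a)" for a b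
  have p: "p a b \<in> B" if "a \<in> A" "b \<in> A" for a b
    using total[OF that] e that unfolding p_def under_def by auto
  show ?thesis
    unfolding discretely_coded_def
  proof (intro exI[of _ "\<lambda>a (b, j). c (p a b) j"] allI)
    fix y :: "'a \<times> 'j \<Rightarrow> nat"
    define z where "z b = d (\<lambda>j. y (b, j))" for b
    let ?H = "\<lambda>b. Pair b ` F (\<lambda>j. y (b, j))"
    have H: "finite (?H b)" "b \<in> A \<Longrightarrow> ?H b \<subseteq> A \<times> J" for b
      using F by auto
    have pz: "p a b = z b" if "a \<in> A" "b \<in> A" "\<forall>j\<in>?H b. (\<lambda>(b, j). c (p a b) j) j = y j" for a b
      unfolding z_def by (rule d) (use that p in auto)
    show "\<exists>H f. finite H \<and> H \<subseteq> A \<times> J \<and>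
        (\<forall>a\<in>A. (\<forall>j\<in>H. (\<lambda>(b, j). c (p a b) j) j = y j) \<longrightarrow> a = f)"
    proof (cases "z ` A \<subseteq> B")
      \<comment> \<open>\<open>d\<close> may return a value outside \<open>B\<close>. Then block
        \<open>b\<close> alone excludes all of \<open>A\<close>, since every \<open>p a b\<close>
        lies in \<open>B\<close>.\<close>
      case False
      then obtain b where b: "b \<in> A" "z b \<notin> B"
        by blast
      then have "\<not> (\<forall>j\<in>?H b. (\<lambda>(b, j). c (p a b) j) j = y j)" if "a \<in> A" for a
        using pz[OF that b(1)] p[OF that b(1)] b(2) by metis
      then show ?thesis
        by (intro exI[of _ "?H b"]) (use H[of b] b(1) in blast)
    next
      case True
      have "\<not> |A| \<le>o |B|"
        using less not_ordLess_ordLeq by blast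
      then have "\<not> inj_on z A"
        using True unfolding card_of_ordLeq[symmetric] by blast
      then obtain b b' where b: "b \<in> A" "b' \<in> A" "b \<noteq> b'" "z b = z b'" "(b, b') \<in> ?r"
        using total unfolding inj_on_def by metis
      show ?thesis
      proof (intro exI[of _ "?H b \<union> ?H b'"] exI conjI ballI impI)
        show "finite (?H b \<union> ?H b')" "?H b \<union> ?H b' \<subseteq> A \<times> J"
          using H b by auto
        fix a
        assume a: "a \<in> A" and agree: "\<forall>j\<in>?H b \<union> ?H b'. (\<lambda>(b, j). c (p a b) j) j = y j"
        have eq: "p a b = z b" "p a b' = z b'"
          using pz[OF a b(1)] pz[OF a b(2)] agree by blast+
        have na: "(b', a) \<notin> ?r"
        proof
          assume "(b', a) \<in> ?r"
          moreover from this have "(b, a) \<in> ?r"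
            using b trans by blast
          ultimately show False
            using eq b inj[OF a] unfolding p_def inj_on_def under_def by auto
        qed
        then have "a \<in> under ?r b'" "e b' a = z b'"
          using eq total[OF a b(2)] unfolding p_def under_def by auto
        then show "a = inv_into (under ?r b') (e b') (z b')"
          using inj[OF b(2)] inv_into_f_f by metis
      qed
    qed
  qed
qed

text \<open>Well-founded induction on \<open>|A|\<close>: an uncountable cardinal that is not weakly
  inaccessible is singular, where \<open>discretely_coded_UN\<close> applies, or a successor, where
  \<open>discretely_coded_step\<close> applies.\<close>

theorem discretely_coded_below_first_weakly_inaccessible:
  fixes A :: "'a set"
  assumes "below_first_weakly_inaccessible |A|"
  shows "discretely_coded A A"
  using assms
proof (induction A rule: wf_induct_rule[OF wf_inv_image[OF wf_ordLess, of card_of]])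
  case (1 A)
  have IH: "discretely_coded B B" if "|B| <o |A|" for B :: "'a set"
  proof (rule 1)
    show "(B, A) \<in> inv_image ordLess card_of"
      using that by simp
    show "below_first_weakly_inaccessible |B|"
      using 1(2) ordLess_transitive[OF that] unfolding below_first_weakly_inaccessible_def by blast
  qed
  let ?r = "|A|"
  have IH': "discretely_coded B A" if "|B| <o ?r" for B :: "'a set"
    by (rule discretely_coded_mono[OF IH[OF that] card_of_mono1[OF subset_refl] ordLess_imp_ordLeq[OF that]])
  show ?case
  proof (cases "countable A")
    case False
    then have inf: "infinite A"
      using countable_finite by blast
    have "\<not> ?r \<le>o natLeq"
      using False countable_card_le_natLeq by metis
    then have unc: "natLeq <o ?r"
      using not_ordLeq_iff_ordLess[OF natLeq_Well_order card_of_Well_order[of A]] by simp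
    have times: "|A \<times> A| \<le>o |A|"
      using card_of_Times_same_infinite[OF inf] ordIso_imp_ordLeq by blast
    have seg: "|underS ?r a| <o ?r" if "a \<in> A" for a
      using card_of_underS[OF card_of_Card_order[of A]] that by (simp add: Field_card_of)
    have "\<not> weakly_inaccessible ?r"
      using 1(2) ordLess_irreflexive unfolding below_first_weakly_inaccessible_def by blast
    then consider "\<not> regularCard ?r" | "\<not> limit_cardinal ?r"
      using unc card_of_Card_order unfolding weakly_inaccessible_def by blast
    then show ?thesis
    proof cases
      case 1
      then obtain K where K: "K \<subseteq> A" "cofinal K ?r" and "\<not> |K| =o ?r"
        unfolding regularCard_def Field_card_of by blast
      then have "|K| <o ?r"
        using card_of_mono1 ordLeq_iff_ordLess_or_ordIso by blast
      then have "discretely_coded K A"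
        by (rule IH')
      moreover have "discretely_coded (underS ?r k) A" if "k \<in> K" for k
        using seg[of k] that K(1) IH' by blast
      ultimately have "discretely_coded (\<Union>k\<in>K. underS ?r k) (A <+> K \<times> A)"
        by (rule discretely_coded_UN)
      \<comment> \<open>Cofinality is strict here, so the strict initial segments below
        \<open>K\<close> cover \<open>A\<close>.\<close>
      moreover have "A \<subseteq> (\<Union>k\<in>K. underS ?r k)"
        using K(2) unfolding cofinal_def underS_def Field_card_of by auto
      moreover have "|A <+> K \<times> A| \<le>o |A|"
      proof -
        have "|K \<times> A| \<le>o |A|"
          using ordLeq_transitive[OF card_of_Times_mono1[OF card_of_mono1[OF K(1)]] times] .
        then show ?thesis
          by (metis card_of_Plus_infinite1 inf ordIso_imp_ordLeq)
      qed
      ultimately show ?thesis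
        using discretely_coded_mono[OF _ card_of_mono1] by metis
    next
      case 2
      then obtain \<mu> :: "'a rel" where \<mu>: "Card_order \<mu>" "\<mu> <o ?r" "\<not> cardSuc \<mu> <o ?r"
        using card_of_Card_order unfolding limit_cardinal_def by blast
      define B where "B = Field \<mu>"
      have B: "|B| =o \<mu>"
        unfolding B_def by (rule card_of_Field_ordIso[OF \<mu>(1)])
      then have less: "|B| <o ?r"
        using \<mu>(2) ordIso_ordLess_trans by blast
      \<comment> \<open>\<open>|A|\<close> is at most the successor of \<open>|B|\<close>, so no
        cardinality lies strictly between the two.\<close>
      have le: "|S| \<le>o |B|" if "|S| <o ?r" for S :: "'a set"
      proof (rule ccontr)
        assume "\<not> |S| \<le>o |B|"
        then have "|B| <o |S|"
          using not_ordLeq_iff_ordLess[OF card_of_Well_order card_of_Well_order] by blast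
        then have "\<mu> <o |S|"
          using B ordIso_symmetric ordIso_ordLess_trans by blast
        then have "cardSuc \<mu> \<le>o |S|"
          using cardSuc_least[OF \<mu>(1) card_of_Card_order] by blast
        then show False
          using that \<mu>(3) ordLeq_ordLess_trans by blast
      qed
      \<comment> \<open>Infinity of \<open>B\<close> absorbs the endpoint when passing from
        \<open>underS\<close> to \<open>under\<close>.\<close>
      have infB: "infinite B"
      proof
        assume "finite B"
        obtain S where S: "S \<subseteq> A" "infinite S" "countable S"
          using infinite_countable_subset'[OF inf] by blast
        have "|S| <o ?r"
          using S(3) unc countable_card_le_natLeq ordLeq_ordLess_trans by metis
        then show False
          using le[of S] S(2) \<open>finite B\<close> card_of_ordLeq_infinite by blast
      qed
      have "|under ?r a| \<le>o |B|" if "a \<in> A" for a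
      proof -
        have "|{a} \<union> underS ?r a| \<le>o |B|"
        proof (rule card_of_Un_ordLeq_infinite_Field)
          show "infinite (Field |B| )" "Card_order |B|"
            using infB card_of_Card_order[of B] by (simp_all add: Field_card_of)
          show "|{a}| \<le>o |B|"
            using infB by (intro card_of_singl_ordLeq) auto
          show "|underS ?r a| \<le>o |B|"
            by (rule le[OF seg[OF that]])
        qed
        moreover have "under ?r a \<subseteq> {a} \<union> underS ?r a"
          unfolding under_def underS_def by auto
        ultimately show ?thesis
          using card_of_mono1 ordLeq_transitive by blast
      qed
      then have "discretely_coded A (A \<times> B)"
        by (rule discretely_coded_step[OF IH[OF less] less])
      moreover have "|A \<times> B| \<le>o |A|"
        using ordLeq_transitive[OF card_of_Times_mono2[OF ordLess_imp_ordLeq[OF less]] times] .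
      ultimately show ?thesis
        using discretely_coded_mono[OF _ card_of_mono1[OF subset_refl]] by metis
    qed
  qed (rule discretely_coded_countable)
qed

section \<open>Counting lists, and closed discrete sets in \<open>T1\<close> spaces\<close>

lemma card_of_lists_le:
  assumes "infinite A"
  shows "|lists A| \<le>o |A|"
proof -
  have le: "|{l \<in> lists A. length l = n}| \<le>o |A|" for n
  proof (induction n)
    case 0
    have "{l \<in> lists A. length l = 0} = {[]}"
      by auto
    then show ?case
      using assms by (metis card_of_singl_ordLeq finite.emptyI)
  next
    case (Suc n)
    have "{l \<in> lists A. length l = Suc n} \<subseteq> (\<lambda>(a, l). a # l) ` (A \<times> {l \<in> lists A. length l = n})"
      by (auto simp: length_Suc_conv)
    then have "|{l \<in> lists A. length l = Suc n}| \<le>o |A \<times> {l \<in> lists A. length l = n}|"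
      by (rule surj_imp_ordLeq)
    moreover have "|A \<times> {l \<in> lists A. length l = n}| \<le>o |A|"
      using card_of_Times_ordLeq_infinite_Field[OF _ card_of_mono1[OF subset_refl] Suc card_of_Card_order]
        assms by (simp add: Field_card_of)
    ultimately show ?case
      using ordLeq_transitive by blast
  qed
  have "|\<Union>n. {l \<in> lists A. length l = n}| \<le>o |A|"
    by (rule card_of_UNION_ordLeq_infinite[OF assms infinite_iff_card_of_nat[THEN iffD1, OF assms]])
      (use le in simp)
  moreover have "(\<Union>n. {l \<in> lists A. length l = n}) = lists A"
    by auto
  ultimately show ?thesis
    by simp
qed

text \<open>In a \<open>T1\<close> space an accumulation point has infinitely many points of
  \<open>D\<close> in each neighbourhood, so the derived set of \<open>D\<close> is empty.\<close>

lemma t1_closed_discrete_inI: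
  assumes "t1_space X" "D \<subseteq> topspace X"
    and "\<And>z. z \<in> topspace X \<Longrightarrow> \<exists>V. openin X V \<and> z \<in> V \<and> finite (D \<inter> V)"
  shows "closed_discrete_in X D"
proof -
  have "X derived_set_of D = {}"
    using assms(1,3) unfolding t1_space_derived_set_of_infinite_openin by blast
  then show ?thesis
    using assms(2) unfolding closed_discrete_in_def
    by (simp add: closedin_contains_derived_set subtopology_eq_discrete_topology_eq)
qed

text \<open>Given a countable open cover without finite subcover, choose \<open>w n\<close> outside
  the first \<open>n\<close> members. Each member then contains \<open>w n\<close> for only finitely
  many \<open>n\<close>.\<close>

lemma not_countably_compact_imp_separated_sequence:
  assumes "t1_space X" "\<not> countably_compact_space X"
  obtains x :: "nat \<Rightarrow> 'a" where "inj x" "range x \<subseteq> topspace X"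
    "\<forall>z\<in>topspace X. \<exists>V m. openin X V \<and> z \<in> V \<and> (\<forall>n. x n \<in> V \<longrightarrow> n = m)"
proof -
  obtain \<U> where \<U>: "countable \<U>" "\<forall>U\<in>\<U>. openin X U" "topspace X \<subseteq> \<Union>\<U>"
    and nofin: "\<And>\<F>. finite \<F> \<Longrightarrow> \<F> \<subseteq> \<U> \<Longrightarrow> \<not> topspace X \<subseteq> \<Union>\<F>"
    using assms(2) unfolding countably_compact_space_def by metis
  define U where "U = from_nat_into \<U>"
  have "\<U> \<noteq> {}"
    using nofin[of "{}"] \<U>(3) by auto
  then have U: "range U = \<U>"
    unfolding U_def using \<U>(1) by (rule range_from_nat_into)
  have "\<exists>w. w \<in> topspace X \<and> w \<notin> \<Union> (U ` {..<n})" for n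
  proof -
    have "\<not> topspace X \<subseteq> \<Union> (U ` {..<n})"
      by (rule nofin) (use U in auto)
    then show ?thesis
      by blast
  qed
  then obtain w where w: "\<And>n. w n \<in> topspace X" and wU: "\<And>n. w n \<notin> \<Union> (U ` {..<n})"
    by metis
  have cov: "\<exists>m. z \<in> U m" if "z \<in> topspace X" for z
    using \<U>(3) that U by blast
  have le: "n \<le> m" if "w n \<in> U m" for n m
    using wU[of n] that by (auto simp: not_less[symmetric])
  \<comment> \<open>A value lying in \<open>U m\<close> occurs only at indices up to
    \<open>m\<close>; finitely many values would bound all indices.\<close>
  have "infinite (range w)"
  proof
    assume fin: "finite (range w)"
    from cov w have "\<forall>n. \<exists>m. w n \<in> U m"
      by blast
    then have "\<forall>r\<in>range w. \<exists>m. r \<in> U m"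
      by blast
    then obtain m where m: "\<forall>r\<in>range w. r \<in> U (m r)"
      by metis
    have "n \<le> Max (m ` range w)" for n
      using le[of n "m (w n)"] m fin by (meson Max_ge finite_imageI imageI order_trans rangeI)
    then show False
      using not_less_eq_eq by blast
  qed
  then obtain x :: "nat \<Rightarrow> 'a" where x: "inj x" "range x \<subseteq> range w"
    unfolding infinite_iff_countable_subset by blast
  show thesis
  proof (rule that[OF x(1)])
    have "range w \<subseteq> topspace X"
      using w by auto
    with x(2) show "range x \<subseteq> topspace X"
      by (rule order_trans)
    show "\<forall>z\<in>topspace X. \<exists>V m. openin X V \<and> z \<in> V \<and> (\<forall>n. x n \<in> V \<longrightarrow> n = m)"
    proof
      fix z
      assume z: "z \<in> topspace X"
      then obtain m where m: "z \<in> U m"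
        using cov by blast
      \<comment> \<open>By \<open>le\<close>, only \<open>w k\<close> with \<open>k \<le> m\<close>
        can lie in \<open>U m\<close>. Removing these finitely many points, except \<open>z\<close>
        itself, leaves \<open>z\<close> as the only possible term.\<close>
      define V where "V = U m - (w ` {..m} - {z})"
      have "openin X V"
        unfolding V_def
      proof (rule openin_diff)
        show "openin X (U m)"
          using \<U>(2) U by blast
        show "closedin X (w ` {..m} - {z})"
          using assms(1) w unfolding t1_space_closedin_finite by (metis (no_types) finite_Diff finite_atMost finite_imageI image_subset_iff Diff_subset order_trans)
      qed
      moreover have "n = inv x z" if n: "x n \<in> V" for n
      proof -
        obtain k where k: "x n = w k"
          using x(2) by blast
        then have "x n = z"
          using n le[of k m] unfolding V_def by auto
        then show ?thesis
          using inv_f_f[OF x(1)] by metis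
      qed
      ultimately show "\<exists>V m. openin X V \<and> z \<in> V \<and> (\<forall>n. x n \<in> V \<longrightarrow> n = m)"
        using m unfolding V_def by blast
    qed
  qed
qed

lemma dense_in_meets_open:
  assumes "dense_in X E" "openin X U" "z \<in> U"
  shows "\<exists>e. e \<in> E \<and> e \<in> U"
proof -
  have "z \<in> X closure_of E"
    using assms openin_subset[OF assms(2)] unfolding dense_in_def by auto
  then show ?thesis
    using assms(2,3) unfolding in_closure_of by blast
qed

section \<open>The closed discrete sets in the power of \<open>X\<close>\<close>

theorem corollary3p8:
  fixes X :: "'a topology" and I :: "'i set"
  assumes "t1_space X"
    and "\<not> countably_compact_space X"
    and "below_first_weakly_inaccessible (topological_density X)"
    and "|I| =o topological_density X"
  shows "e_separable (product_topology (\<lambda>i. X) I)"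
proof -
  obtain x :: "nat \<Rightarrow> 'a" where x: "inj x" "range x \<subseteq> topspace X"
    and sep: "\<forall>z\<in>topspace X. \<exists>V m. openin X V \<and> z \<in> V \<and> (\<forall>n. x n \<in> V \<longrightarrow> n = m)"
    by (rule not_countably_compact_imp_separated_sequence[OF assms(1,2)])
  obtain E where E: "dense_in X E" "|E| =o topological_density X"
    using topological_density_properties(2) by blast
  have EI: "|E| =o |I|"
    by (rule ordIso_transitive[OF E(2) ordIso_symmetric[OF assms(4)]])
  \<comment> \<open>A finite dense set would be closed and hence all of \<open>X\<close>, which
    contains the infinite set \<open>range x\<close>.\<close>
  have infE: "infinite E"
  proof
    assume "finite E"
    then have "closedin X E"
      using assms(1) E(1) by (simp add: t1_space_closedin_finite dense_in_def)
    then have "topspace X = E"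
      using E(1) unfolding dense_in_def by (simp add: closure_of_closedin)
    then show False
      using x(2) \<open>finite E\<close> range_inj_infinite[OF x(1)] finite_subset by metis
  qed
  then have infI: "infinite I"
    using card_of_ordIso_finite[OF EI] by simp
  have "below_first_weakly_inaccessible |E|"
    using assms(3) ordIso_ordLess_trans[OF E(2)] unfolding below_first_weakly_inaccessible_def by blast
  then have coded: "discretely_coded E E"
    by (rule discretely_coded_below_first_weakly_inaccessible)
  \<comment> \<open>A list of pairs (coordinate, value) stands for a finitely supported point, read
    off by \<open>map_of\<close>; there are at most \<open>|E|\<close> lists.\<close>
  define L where "L = lists (I \<times> E)"
  have "|I \<times> E| \<le>o |E|"
    using card_of_Times_ordLeq_infinite_Field[OF _ ordIso_imp_ordLeq[OF ordIso_symmetric[OF EI]]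
        card_of_mono1[OF subset_refl] card_of_Card_order] infE by (simp add: Field_card_of)
  moreover have "infinite (I \<times> E)"
    using infE infI by (auto simp: finite_cartesian_product_iff)
  ultimately have L: "|L| \<le>o |E|"
    unfolding L_def using ordLeq_transitive[OF card_of_lists_le] by metis
  have "|(UNIV :: nat set) \<times> I| =o |I|"
    using card_of_Times_infinite_simps(3)[OF infI UNIV_not_empty] infI
    unfolding infinite_iff_card_of_nat .
  \<comment> \<open>\<open>h\<close> cuts \<open>I\<close> into the disjoint blocks
    \<open>J n\<close>, each of size \<open>|I|\<close>.\<close>
  then obtain h where h: "bij_betw h ((UNIV :: nat set) \<times> I) I"
    unfolding card_of_ordIso[symmetric] by blast
  define J where "J n = h ` ({n} \<times> I)" for n
  have J: "J n \<subseteq> I" for n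
    using h unfolding J_def bij_betw_def by blast
  have "discretely_coded L (J n)" for n
  proof -
    have "inj_on (\<lambda>i. h (n, i)) I"
      using h unfolding bij_betw_def inj_on_def by auto
    then have "|I| \<le>o |J n|"
      unfolding card_of_ordLeq[symmetric] J_def by blast
    then show ?thesis
      by (rule discretely_coded_mono[OF coded L ordIso_ordLeq_trans[OF EI]])
  qed
  then have "\<forall>n. \<exists>c :: ('i \<times> 'a) list \<Rightarrow> 'i \<Rightarrow> nat. \<forall>y. \<exists>F d. finite F \<and> F \<subseteq> J n \<and>
      (\<forall>l\<in>L. (\<forall>i\<in>F. c l i = y i) \<longrightarrow> l = d)"
    unfolding discretely_coded_def by (rule allI)
  then obtain c :: "nat \<Rightarrow> ('i \<times> 'a) list \<Rightarrow> 'i \<Rightarrow> nat"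
    where c: "\<forall>n y. \<exists>F d. finite F \<and> F \<subseteq> J n \<and> (\<forall>l\<in>L. (\<forall>i\<in>F. c n l i = y i) \<longrightarrow> l = d)"
    by (rule choice[THEN exE])
  \<comment> \<open>Block \<open>n\<close> holds the code of \<open>l\<close>, written with the
    points of the sequence \<open>x\<close>. Elsewhere \<open>l\<close> gives the value, with
    default \<open>x 0\<close>.\<close>
  define p where "p n l = (\<lambda>i\<in>I. if i \<in> J n then x (c n l i)
      else case map_of l i of None \<Rightarrow> x 0 | Some e \<Rightarrow> e)" for n l
  let ?P = "product_topology (\<lambda>i. X) I"
  have ptop: "p n l \<in> topspace ?P" if "l \<in> L" for n l
  proof -
    have "snd ` set l \<subseteq> topspace X"
      using that E(1) unfolding L_def dense_in_def by auto
    then have "e \<in> topspace X" if "map_of l i = Some e" for i e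
      using map_of_SomeD[OF that] by force
    moreover have "x k \<in> topspace X" for k
      using x(2) by blast
    ultimately show ?thesis
      unfolding p_def by (auto split: option.split)
  qed
  have "closed_discrete_in ?P (p n ` L)" for n
  proof (rule t1_closed_discrete_inI)
    show "t1_space ?P"
      using assms(1) by (simp add: t1_space_product_topology)
    show "p n ` L \<subseteq> topspace ?P"
      using ptop by blast
    fix z
    assume z: "z \<in> topspace ?P"
    then have "\<forall>i\<in>I. z i \<in> topspace X"
      by auto
    then have "\<forall>i\<in>I. \<exists>V m. openin X V \<and> z i \<in> V \<and> (\<forall>n. x n \<in> V \<longrightarrow> n = m)"
      using sep by blast
    then obtain V m where Vm: "\<forall>i\<in>I. openin X (V i) \<and> z i \<in> V i \<and> (\<forall>n. x n \<in> V i \<longrightarrow> n = m i)"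
      by metis
    then have V: "\<And>i. i \<in> I \<Longrightarrow> openin X (V i)" "\<And>i. i \<in> I \<Longrightarrow> z i \<in> V i"
      and m: "\<And>i n. i \<in> I \<Longrightarrow> x n \<in> V i \<Longrightarrow> n = m i"
      by blast+
    \<comment> \<open>The indices \<open>m\<close> form the point to be decoded: if
      \<open>p n l\<close> lies in \<open>V i\<close> for all \<open>i\<close> in \<open>F\<close>,
      its code agrees with \<open>m\<close> on \<open>F\<close>, which forces
      \<open>l = d\<close>.\<close>
    obtain F d where F: "finite F" "F \<subseteq> J n" and d: "\<forall>l\<in>L. (\<forall>i\<in>F. c n l i = m i) \<longrightarrow> l = d"
      using c[THEN spec, THEN spec, of n m] by blast
    define W where "W = Pi\<^sub>E I (\<lambda>i. if i \<in> F then V i else topspace X)"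
    have "openin ?P W"
      unfolding W_def openin_PiE_gen using V(1) F(1) by (auto intro!: finite_subset[OF _ F(1)])
    moreover have "z \<in> W"
      using z V(2) unfolding W_def by (auto simp: PiE_iff)
    moreover have "p n ` L \<inter> W \<subseteq> {p n d}"
    proof clarsimp
      fix l
      assume l: "l \<in> L" "p n l \<in> W"
      have "c n l i = m i" if "i \<in> F" for i
      proof (rule m)
        show "i \<in> I"
          using that F(2) J by blast
        then show "x (c n l i) \<in> V i"
          using l(2) that F(2) unfolding W_def p_def by (auto simp: PiE_iff split: if_splits)
      qed
      then show "p n l = p n d"
        using d l(1) by blast
    qed
    ultimately show "\<exists>W. openin ?P W \<and> z \<in> W \<and> finite (p n ` L \<inter> W)"
      using finite_subset by blast
  qed
  moreover have "dense_in ?P (\<Union>n. p n ` L)"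
    unfolding dense_in_def
  proof
    show "(\<Union>n. p n ` L) \<subseteq> topspace ?P"
      using ptop by blast
    have "\<exists>q. q \<in> (\<Union>n. p n ` L) \<and> q \<in> T" if T: "z \<in> T" "openin ?P T" for z T
    proof -
      obtain U where fin: "finite {i \<in> I. U i \<noteq> topspace X}" and U: "\<forall>i\<in>I. openin X (U i)"
        and zU: "z \<in> Pi\<^sub>E I U" and sub: "Pi\<^sub>E I U \<subseteq> T"
        using bspec[OF openin_product_topology_alt[THEN iffD1, OF T(2)] T(1)] by blast
      let ?F = "{i \<in> I. U i \<noteq> topspace X}"
      \<comment> \<open>\<open>fst\<close> of the inverse of \<open>h\<close> is the block number,
        so block \<open>n\<close> avoids every restricted coordinate.\<close>
      obtain n where n: "n \<notin> (fst \<circ> inv_into (UNIV \<times> I) h) ` ?F"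
        using ex_new_if_finite[OF infinite_UNIV_nat finite_imageI[OF fin]] by blast
      have nJ: "i \<notin> J n" if "i \<in> ?F" for i
      proof
        assume "i \<in> J n"
        then obtain j where "j \<in> I" "i = h (n, j)"
          unfolding J_def by auto
        then have "inv_into (UNIV \<times> I) h i = (n, j)"
          using h unfolding bij_betw_def by (simp add: inv_into_f_f)
        then show False
          using n that by force
      qed
      have "\<forall>i\<in>I. \<exists>e. e \<in> E \<and> e \<in> U i"
        using dense_in_meets_open[OF E(1)] U zU by (meson PiE_mem)
      then obtain e where e: "\<forall>i\<in>I. e i \<in> E \<and> e i \<in> U i"
        by (rule bchoice[THEN exE])
      obtain xs where xs: "set xs = ?F"
        using finite_list[OF fin] by blast
      \<comment> \<open>Repetitions in \<open>xs\<close> do no harm, since equal coordinates receive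
        the same value \<open>e i\<close>.\<close>
      define l where "l = map (\<lambda>i. (i, e i)) xs"
      have l: "l \<in> L"
        unfolding L_def l_def using xs e by auto
      have val: "p n l i = e i" if "i \<in> ?F" for i
        using that nJ[OF that] xs unfolding p_def l_def map_of_map_restrict by auto
      have "p n l i \<in> U i" if "i \<in> I" for i
      proof (cases "i \<in> ?F")
        case True
        then show ?thesis
          using val e that by simp
      next
        case False
        then show ?thesis
          using ptop[OF l] that by (auto simp: PiE_iff)
      qed
      then have "p n l \<in> Pi\<^sub>E I U"
        unfolding p_def by auto
      then show ?thesis
        using l sub by blast
    qed
    then show "?P closure_of (\<Union>n. p n ` L) = topspace ?P"
      unfolding set_eq_iff in_closure_of by blast
  qed
  ultimately show ?thesis
    unfolding e_separable_def by (intro exI[of _ "\<lambda>n. p n ` L"]) blast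
qed

end
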